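(* Let $\psi\in\mathcal{D}$ be a DQBF and let $\exists y(D_y):\varphi$ be a subformula of $\psi$ such that $V^\forall_\varphi=V^\exists_\varphi=\emptyset$ and $V_\varphi\subseteq D_y\cup V^{\mathrm{free}}_\psi\cup\{v\in V^\exists_\psi\mid D_v\subseteq D_y\}$. Let $\psi'$ result from $\psi$ by replacing the subformula $\exists y(D_y):\varphi$ by $\varphi[0/y]\vee\varphi[1/y]$. Then $\psi$ and $\psi'$ are equisatisfiable.
   Context: Notation: $\mathcal{F}(W)$ is the set of Boolean functions over variable set $W$; $\mathrm{supp}(f)$ the set of variables $f$ depends on; $\varphi[c/y]$ substitutes the constant $c$ for $y$. Syntax (non-closed non-prenex DQBFs in NNF over a finite variable set $V$). The set $\mathcal{D}$, with for each $\psi$ the sets $V^{\exists}_\psi$ (existential), $V^{\forall}_\psi$ (universal), $V^{\mathrm{fs}}_\psi$ (free variables occurring in $\psi$), and a dependency set $D_y\subseteq V$ for each existential $y$, is the smallest set closed under: (1) $v\in\mathcal{D}$ for $v\in V$ ($V^\exists=V^\forall=\emptyset$, $V^{\mathrm{fs}}=\{v\}$); (2) $\neg v\in\mathcal{D}$, same sets; (3),(4) if $\varphi_1,\varphi_2\in\mathcal{D}$ and $\bigl(V^Q_{\varphi_1}\cup V^{\mathrm{fs}}_{\varphi_1}\cup\bigcup_{y\in V^\exists_{\varphi_1}}D_y\bigr)\cap V^Q_{\varphi_2}=\emptyset$ and symmetrically, then $(\varphi_1\wedge\varphi_2),(\varphi_1\vee\varphi_2)\in\mathcal{D}$ with all three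 sets the unions; (5) if $\varphi\in\mathcal{D}$, $v\in V^{\mathrm{free}}_\varphi$, $D_v\subseteq V\setminus(V^Q_\varphi\cup\{v\})$, then $\exists v(D_v):\varphi^{-v}\in\mathcal{D}$ ($\varphi^{-v}$: remove $v$ from all dependency sets in $\varphi$), with $V^\exists=V^\exists_\varphi\cup\{v\}$, $V^{\mathrm{fs}}=V^{\mathrm{fs}}_\varphi\setminus\{v\}$; (6) if $\varphi\in\mathcal{D}$, $v\in V^{\mathrm{free}}_\varphi$, then $\forall v:\varphi\in\mathcal{D}$ with $V^\forall=V^\forall_\varphi\cup\{v\}$, $V^{\mathrm{fs}}=V^{\mathrm{fs}}_\varphi\setminus\{v\}$. Here $V^Q_\psi=V^\exists_\psi\cup V^\forall_\psi$, $V_\psi=V^Q_\psi\cup V^{\mathrm{fs}}_\psi$, $V^{\mathrm{free}}_\psi=V\setminus V^Q_\psi$. Semantics. A Skolem function candidate for $\psi$ is a map $s:V^{\mathrm{free}}_\psi\cup V^\exists_\psi\to\mathcal{F}(V^\forall_\psi)$ with $s(v)$ constant for free $v$ and $\mathrm{supp}(s(v))\subseteq D_v\cap V^\forall_\psi$ for existential $v$. $s(\psi)$ replaces each such $v$ by $s(v)$ and deletes quantifiers. $[\![\psi]\!]$ is the set of candidates $s$ with $s(\psi)$ a tautology. $\psi_1\approx\psi_2$ (equisatisfiable) iff $[\![\psi_1]\!]=\emptyset\Leftrightarrow[\![\psi_2]\!]=\emptyset$. *)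

theory Defs
  imports Main "HOL-Library.FuncSet"
begin

text \<open>
  The finite variable set \<open>V\<close> is the universe of a finite type \<open>'v\<close>. The datatype contains the raw
  formulas; the set \<open>\<D>\<close> of well-formed DQBFs is carved out of it by \<open>DQBF\<close> below.
  The constants \<open>Cst b\<close> are not part of \<open>\<D>\<close>; they only arise from substituting a truth value for
  a variable.
\<close>

datatype 'v dqbf =
    Cst bool
  | Var 'v
  | NegVar 'v
  | And "'v dqbf" "'v dqbf"
  | Or "'v dqbf" "'v dqbf"
  | Exists 'v "'v set" "'v dqbf"
  | Forall 'v "'v dqbf"

primrec V_ex :: "'v dqbf \<Rightarrow> 'v set" where
  "V_ex (Cst b) = {}"
| "V_ex (Var v) = {}"
| "V_ex (NegVar v) = {}"
| "V_ex (And f g) = V_ex f \<union> V_ex g"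
| "V_ex (Or f g) = V_ex f \<union> V_ex g"
| "V_ex (Exists v D f) = V_ex f \<union> {v}"
| "V_ex (Forall v f) = V_ex f"

primrec V_all :: "'v dqbf \<Rightarrow> 'v set" where
  "V_all (Cst b) = {}"
| "V_all (Var v) = {}"
| "V_all (NegVar v) = {}"
| "V_all (And f g) = V_all f \<union> V_all g"
| "V_all (Or f g) = V_all f \<union> V_all g"
| "V_all (Exists v D f) = V_all f"
| "V_all (Forall v f) = V_all f \<union> {v}"

text \<open>The free variables that occur in a formula.\<close>

primrec V_fs :: "'v dqbf \<Rightarrow> 'v set" where
  "V_fs (Cst b) = {}"
| "V_fs (Var v) = {v}"
| "V_fs (NegVar v) = {v}"
| "V_fs (And f g) = V_fs f \<union> V_fs g"
| "V_fs (Or f g) = V_fs f \<union> V_fs g"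
| "V_fs (Exists v D f) = V_fs f - {v}"
| "V_fs (Forall v f) = V_fs f - {v}"

definition V_Q :: "'v dqbf \<Rightarrow> 'v set" where
  "V_Q f = V_ex f \<union> V_all f"

definition V_of :: "'v dqbf \<Rightarrow> 'v set" where
  "V_of f = V_Q f \<union> V_fs f"

text \<open>All variables of \<open>V\<close> that are not quantified, whether or not they occur.\<close>

definition V_free :: "'v dqbf \<Rightarrow> 'v set" where
  "V_free f = UNIV - V_Q f"

text \<open>
  The dependency set of \<open>y\<close> in a formula. Well-formed formulas quantify each variable at most once,
  so for an existential variable the unions below pick out its one annotation; for any other
  variable the value is the junk value \<open>{}\<close>.
\<close>

primrec dep :: "'v dqbf \<Rightarrow> 'v \<Rightarrow> 'v set" where
  "dep (Cst b) y = {}"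
| "dep (Var v) y = {}"
| "dep (NegVar v) y = {}"
| "dep (And f g) y = dep f y \<union> dep g y"
| "dep (Or f g) y = dep f y \<union> dep g y"
| "dep (Exists v D f) y = (if v = y then D else {}) \<union> dep f y"
| "dep (Forall v f) y = dep f y"

text \<open>\<open>remove_dep v f\<close> is \<open>f\<close> with \<open>v\<close> removed from all dependency sets.\<close>

primrec remove_dep :: "'v \<Rightarrow> 'v dqbf \<Rightarrow> 'v dqbf" where
  "remove_dep x (Cst b) = Cst b"
| "remove_dep x (Var v) = Var v"
| "remove_dep x (NegVar v) = NegVar v"
| "remove_dep x (And f g) = And (remove_dep x f) (remove_dep x g)"
| "remove_dep x (Or f g) = Or (remove_dep x f) (remove_dep x g)"
| "remove_dep x (Exists v D f) = Exists v (D - {x}) (remove_dep x f)"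
| "remove_dep x (Forall v f) = Forall v (remove_dep x f)"

definition compatible :: "'v dqbf \<Rightarrow> 'v dqbf \<Rightarrow> bool" where
  "compatible f g \<longleftrightarrow> (V_Q f \<union> V_fs f \<union> (\<Union>y\<in>V_ex f. dep f y)) \<inter> V_Q g = {}"

inductive_set DQBF :: "'v dqbf set" where
  Var: "Var v \<in> DQBF"
| NegVar: "NegVar v \<in> DQBF"
| And: "\<lbrakk>f \<in> DQBF; g \<in> DQBF; compatible f g; compatible g f\<rbrakk> \<Longrightarrow> And f g \<in> DQBF"
| Or: "\<lbrakk>f \<in> DQBF; g \<in> DQBF; compatible f g; compatible g f\<rbrakk> \<Longrightarrow> Or f g \<in> DQBF"
| Exists: "\<lbrakk>f \<in> DQBF; v \<in> V_free f; D \<subseteq> UNIV - (V_Q f \<union> {v})\<rbrakk>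
    \<Longrightarrow> Exists v D (remove_dep v f) \<in> DQBF"
| Forall: "\<lbrakk>f \<in> DQBF; v \<in> V_free f\<rbrakk> \<Longrightarrow> Forall v f \<in> DQBF"


text \<open>
  Boolean functions act on assignments of all variables; \<open>bool_funs W\<close>, the Boolean functions over
  \<open>W\<close>, are those whose value is determined by the restriction of the assignment to \<open>W\<close>.
\<close>

type_synonym 'v bool_fun = "('v \<Rightarrow> bool) \<Rightarrow> bool"

definition bool_funs :: "'v set \<Rightarrow> 'v bool_fun set" where
  "bool_funs W = {h. \<forall>a b. (\<forall>w\<in>W. a w = b w) \<longrightarrow> h a = h b}"

definition supp :: "'v bool_fun \<Rightarrow> 'v set" where
  "supp h = {v. \<exists>a. h (a(v := False)) \<noteq> h (a(v := True))}"

definition skolem_candidates :: "'v dqbf \<Rightarrow> ('v \<Rightarrow> 'v bool_fun) set" where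
  "skolem_candidates f =
    {s \<in> (V_free f \<union> V_ex f) \<rightarrow>\<^sub>E bool_funs (V_all f).
      (\<forall>v\<in>V_free f. \<exists>c. s v = (\<lambda>a. c)) \<and>
      (\<forall>v\<in>V_ex f. supp (s v) \<subseteq> dep f v \<inter> V_all f)}"

text \<open>
  Replace every variable \<open>v\<close> by the Boolean function \<open>\<sigma> v\<close> and delete all quantifiers.
\<close>

primrec subst_funs :: "('v \<Rightarrow> 'v bool_fun) \<Rightarrow> 'v dqbf \<Rightarrow> 'v bool_fun" where
  "subst_funs \<sigma> (Cst b) = (\<lambda>a. b)"
| "subst_funs \<sigma> (Var v) = \<sigma> v"
| "subst_funs \<sigma> (NegVar v) = (\<lambda>a. \<not> \<sigma> v a)"
| "subst_funs \<sigma> (And f g) = (\<lambda>a. subst_funs \<sigma> f a \<and> subst_funs \<sigma> g a)"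
| "subst_funs \<sigma> (Or f g) = (\<lambda>a. subst_funs \<sigma> f a \<or> subst_funs \<sigma> g a)"
| "subst_funs \<sigma> (Exists v D f) = subst_funs \<sigma> f"
| "subst_funs \<sigma> (Forall v f) = subst_funs \<sigma> f"

text \<open>The Boolean function \<open>s(f)\<close>: universal variables of \<open>f\<close> stand for themselves.\<close>

definition apply_skolem :: "('v \<Rightarrow> 'v bool_fun) \<Rightarrow> 'v dqbf \<Rightarrow> 'v bool_fun" where
  "apply_skolem s f =
    subst_funs (\<lambda>v. if v \<in> V_free f \<union> V_ex f then s v else (\<lambda>a. a v)) f"

definition tautology :: "'v bool_fun \<Rightarrow> bool" where
  "tautology h \<longleftrightarrow> (\<forall>a. h a)"

definition sem :: "'v dqbf \<Rightarrow> ('v \<Rightarrow> 'v bool_fun) set" where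
  "sem f = {s \<in> skolem_candidates f. tautology (apply_skolem s f)}"

definition equisatisfiable :: "'v dqbf \<Rightarrow> 'v dqbf \<Rightarrow> bool" (infix \<open>\<approx>\<close> 50) where
  "f \<approx> g \<longleftrightarrow> (sem f = {} \<longleftrightarrow> sem g = {})"


primrec subformulas :: "'v dqbf \<Rightarrow> 'v dqbf set" where
  "subformulas (Cst b) = {Cst b}"
| "subformulas (Var v) = {Var v}"
| "subformulas (NegVar v) = {NegVar v}"
| "subformulas (And f g) = {And f g} \<union> subformulas f \<union> subformulas g"
| "subformulas (Or f g) = {Or f g} \<union> subformulas f \<union> subformulas g"
| "subformulas (Exists v D f) = {Exists v D f} \<union> subformulas f"
| "subformulas (Forall v f) = {Forall v f} \<union> subformulas f"

text \<open>
  \<open>replace p q f\<close> replaces the occurrences of the subformula \<open>p\<close> in \<open>f\<close> by \<open>q\<close>. In a well-formed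
  formula a quantified subformula occurs only once, as no variable is quantified twice.
\<close>

primrec replace :: "'v dqbf \<Rightarrow> 'v dqbf \<Rightarrow> 'v dqbf \<Rightarrow> 'v dqbf" where
  "replace p q (Cst b) = (if Cst b = p then q else Cst b)"
| "replace p q (Var v) = (if Var v = p then q else Var v)"
| "replace p q (NegVar v) = (if NegVar v = p then q else NegVar v)"
| "replace p q (And f g) =
    (if And f g = p then q else And (replace p q f) (replace p q g))"
| "replace p q (Or f g) =
    (if Or f g = p then q else Or (replace p q f) (replace p q g))"
| "replace p q (Exists v D f) =
    (if Exists v D f = p then q else Exists v D (replace p q f))"
| "replace p q (Forall v f) =
    (if Forall v f = p then q else Forall v (replace p q f))"

text \<open>\<open>subst_const c y f\<close> is \<open>f[c/y]\<close>: free occurrences of \<open>y\<close> as a literal become constants.\<close>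

primrec subst_const :: "bool \<Rightarrow> 'v \<Rightarrow> 'v dqbf \<Rightarrow> 'v dqbf" where
  "subst_const c y (Cst b) = Cst b"
| "subst_const c y (Var v) = (if v = y then Cst c else Var v)"
| "subst_const c y (NegVar v) = (if v = y then Cst (\<not> c) else NegVar v)"
| "subst_const c y (And f g) = And (subst_const c y f) (subst_const c y g)"
| "subst_const c y (Or f g) = Or (subst_const c y f) (subst_const c y g)"
| "subst_const c y (Exists v D f) =
    Exists v D (if v = y then f else subst_const c y f)"
| "subst_const c y (Forall v f) =
    Forall v (if v = y then f else subst_const c y f)"

end

theory Submission imports Defs begin

text \<open>
  From a Skolem function for \<open>\<psi>'\<close> one obtains one for \<open>\<psi>\<close> by choosing \<open>\<phi>[1/y]\<close>, with the other
  Skolem functions substituted, for \<open>y\<close>: at every assignment \<open>\<phi>\<close> then has the value of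
  \<open>\<phi>[0/y] \<or> \<phi>[1/y]\<close>, and the hypothesis on the variables of \<open>\<phi>\<close> bounds the support by \<open>D\<^sub>y\<close>.
  In the other direction \<open>y\<close> may take any constant value, since \<open>\<phi>\<close> implies \<open>\<phi>[0/y] \<or> \<phi>[1/y]\<close> and
  the subformula occurs positively.
\<close>

text \<open>
  The rule \<open>Exists\<close> of \<open>DQBF\<close> changes its premise by \<open>remove_dep\<close>, so subformulas of a formula in
  \<open>DQBF\<close> need not have been built on the way; the following invariant passes to subformulas and
  allows structural induction.
\<close>

primrec well_scoped :: "'v dqbf \<Rightarrow> bool" where
  "well_scoped (Cst b) = True"
| "well_scoped (Var v) = True"
| "well_scoped (NegVar v) = True"
| "well_scoped (And f g) = (well_scoped f \<and> well_scoped g \<and> compatible f g \<and> compatible g f)"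
| "well_scoped (Or f g) = (well_scoped f \<and> well_scoped g \<and> compatible f g \<and> compatible g f)"
| "well_scoped (Exists v D f) =
    (well_scoped f \<and> v \<notin> V_Q f \<and> D \<inter> V_Q f = {} \<and> v \<notin> D \<and> (\<forall>u. v \<notin> dep f u))"
| "well_scoped (Forall v f) = (well_scoped f \<and> v \<notin> V_Q f)"

section \<open>Quantified variables and dependency sets\<close>

lemma V_remove_dep [simp]:
  "V_ex (remove_dep x f) = V_ex f"
  "V_all (remove_dep x f) = V_all f"
  "V_fs (remove_dep x f) = V_fs f"
  "V_Q (remove_dep x f) = V_Q f"
  by (induction f) (auto simp: V_Q_def)

lemma dep_remove_dep [simp]: "dep (remove_dep x f) u = dep f u - {x}"
  by (induction f) auto

text \<open>Dependency sets only shrink and the quantified variables stay the same, so every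
  disjointness condition survives.\<close>

lemma well_scoped_remove_dep: "well_scoped f \<Longrightarrow> well_scoped (remove_dep x f)"
  by (induction f) (auto simp: compatible_def)

lemma DQBF_well_scoped: "f \<in> DQBF \<Longrightarrow> well_scoped f"
proof (induction rule: DQBF.induct)
  case (Exists f v D)
  then show ?case
    using well_scoped_remove_dep[of f v] by (auto simp: V_free_def)
qed (auto simp: V_free_def)

lemma dep_eq_empty: "u \<notin> V_ex f \<Longrightarrow> dep f u = {}"
  by (induction f) auto

lemma V_ex_Int_V_all: "well_scoped f \<Longrightarrow> V_ex f \<inter> V_all f = {}"
  by (induction f) (auto simp: compatible_def V_Q_def)

text \<open>In \<open>And\<close> and \<open>Or\<close> only the operand that quantifies
  \<open>u\<close> contributes to \<open>dep\<close>, and compatibility keeps that set away from the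
  quantified variables of the other one. Universal variables may lie in dependency sets, hence
  \<open>V_ex\<close> and not \<open>V_Q\<close>.\<close>

lemma dep_Int_V_ex: "well_scoped f \<Longrightarrow> dep f u \<inter> V_ex f = {}"
proof (induction f)
  case (And f g)
  then show ?case
    using dep_eq_empty[of u f] dep_eq_empty[of u g]
    by (cases "u \<in> V_ex f"; cases "u \<in> V_ex g") (auto simp: compatible_def V_Q_def)
next
  case (Or f g)
  then show ?case
    using dep_eq_empty[of u f] dep_eq_empty[of u g]
    by (cases "u \<in> V_ex f"; cases "u \<in> V_ex g") (auto simp: compatible_def V_Q_def)
next
  case (Exists v D f)
  then show ?case by (auto simp: V_Q_def)
qed auto

lemma Exists_subformula_V_ex: "Exists y D \<phi> \<in> subformulas f \<Longrightarrow> y \<in> V_ex f"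
  by (induction f) auto

lemma Exists_subformula_dep: "Exists y D \<phi> \<in> subformulas f \<Longrightarrow> D \<subseteq> dep f y"
  by (induction f) auto

section \<open>Values and supports under substitution\<close>

lemma V_Q_subst_const [simp]:
  "V_ex (subst_const c y f) = V_ex f"
  "V_all (subst_const c y f) = V_all f"
  by (induction f) auto

text \<open>Serves both to change the Skolem functions at a fixed assignment and to change the
  assignment for fixed Skolem functions. Bound variables count too, since \<open>subst_funs\<close>
  deletes quantifiers.\<close>

lemma subst_funs_cong:
  "(\<And>w. w \<in> V_of f \<Longrightarrow> \<sigma> w a = \<tau> w b) \<Longrightarrow> subst_funs \<sigma> f a = subst_funs \<tau> f b"
proof (induction f)
  case (And f g)
  have "subst_funs \<sigma> f a = subst_funs \<tau> f b"
    by (rule And.IH(1)) (rule And.prems, auto simp: V_of_def V_Q_def)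
  moreover have "subst_funs \<sigma> g a = subst_funs \<tau> g b"
    by (rule And.IH(2)) (rule And.prems, auto simp: V_of_def V_Q_def)
  ultimately show ?case by simp
next
  case (Or f g)
  have "subst_funs \<sigma> f a = subst_funs \<tau> f b"
    by (rule Or.IH(1)) (rule Or.prems, auto simp: V_of_def V_Q_def)
  moreover have "subst_funs \<sigma> g a = subst_funs \<tau> g b"
    by (rule Or.IH(2)) (rule Or.prems, auto simp: V_of_def V_Q_def)
  ultimately show ?case by simp
next
  case (Exists v D f)
  have "subst_funs \<sigma> f a = subst_funs \<tau> f b"
    by (rule Exists.IH) (rule Exists.prems, auto simp: V_of_def V_Q_def)
  then show ?case by simp
next
  case (Forall v f)
  have "subst_funs \<sigma> f a = subst_funs \<tau> f b"
    by (rule Forall.IH) (rule Forall.prems, auto simp: V_of_def V_Q_def)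
  then show ?case by simp
qed (auto simp: V_of_def V_Q_def)

text \<open>\<open>subst_const\<close> stops at a quantifier of \<open>y\<close> while
  \<open>subst_funs\<close> ignores quantifiers; on quantifier-free formulas this difference
  vanishes.\<close>

lemma subst_funs_subst_const:
  "V_Q f = {} \<Longrightarrow> subst_funs \<sigma> (subst_const c y f) = subst_funs (\<sigma>(y := \<lambda>a. c)) f"
  by (induction f) (auto simp: V_Q_def)

lemma subst_funs_bool_funs:
  "(\<And>v. v \<in> V_of f \<Longrightarrow> \<sigma> v \<in> bool_funs W) \<Longrightarrow> subst_funs \<sigma> f \<in> bool_funs W"
  unfolding bool_funs_def by (simp, intro allI impI subst_funs_cong) blast

text \<open>Flipping \<open>x\<close> can change the value of the formula only by changing the value
  of some \<open>\<sigma> v\<close>.\<close>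

lemma supp_subst_funs: "supp (subst_funs \<sigma> f) \<subseteq> (\<Union>v\<in>V_of f. supp (\<sigma> v))"
proof
  fix x assume "x \<in> supp (subst_funs \<sigma> f)"
  then obtain a where "subst_funs \<sigma> f (a(x := False)) \<noteq> subst_funs \<sigma> f (a(x := True))"
    by (auto simp: supp_def)
  then obtain w where "w \<in> V_of f" "\<sigma> w (a(x := False)) \<noteq> \<sigma> w (a(x := True))"
    using subst_funs_cong[of f \<sigma> "a(x := False)" \<sigma> "a(x := True)"] by blast
  then show "x \<in> (\<Union>v\<in>V_of f. supp (\<sigma> v))"
    by (auto simp: supp_def)
qed

section \<open>Replacing the existential subformula\<close>

lemma replace_id: "p \<notin> subformulas f \<Longrightarrow> replace p q f = f"
  by (induction f) auto

text \<open>Confines the replacement to one operand: \<open>y\<close> is quantified in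
  \<open>f\<close>, so compatibility bars it from \<open>g\<close>.\<close>

lemma Exists_subformula_disjoint:
  assumes "Exists y D \<phi> \<in> subformulas f" "compatible f g" "compatible g f"
  shows "y \<notin> V_ex g" "y \<notin> V_of g"
  using Exists_subformula_V_ex[OF assms(1)] assms(2,3)
  by (auto simp: compatible_def V_Q_def V_of_def)

lemma replace_disjoint: "y \<notin> V_ex f \<Longrightarrow> replace (Exists y D \<phi>) q f = f"
  using replace_id Exists_subformula_V_ex by metis

context
  fixes y :: 'v and D :: "'v set" and \<phi> q :: "'v dqbf"
  assumes V_phi: "V_Q \<phi> = {}" and V_q: "V_Q q = {}"
begin

lemma V_all_replace: "V_all (replace (Exists y D \<phi>) q f) = V_all f"
  using V_phi V_q by (induction f) (auto simp: V_Q_def)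

lemma dep_replace: "u \<noteq> y \<Longrightarrow> dep (replace (Exists y D \<phi>) q f) u = dep f u"
  using V_phi V_q by (induction f) (auto simp: V_Q_def dep_eq_empty)

text \<open>No other quantifier of \<open>y\<close> survives, because scoping allows just
  one.\<close>

lemma V_ex_replace:
  "well_scoped f \<Longrightarrow> Exists y D \<phi> \<in> subformulas f
    \<Longrightarrow> V_ex (replace (Exists y D \<phi>) q f) = V_ex f - {y}"
proof (induction f)
  case (And f g)
  then consider "Exists y D \<phi> \<in> subformulas f" | "Exists y D \<phi> \<in> subformulas g" by auto
  then show ?case
  proof cases
    case 1
    then have "y \<notin> V_ex g" using And.prems Exists_subformula_disjoint(1)[OF 1] by simp
    then show ?thesis using And.prems And.IH(1) 1 by (auto simp: replace_disjoint)
  next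
    case 2
    then have "y \<notin> V_ex f" using And.prems Exists_subformula_disjoint(1)[OF 2] by simp
    then show ?thesis using And.prems And.IH(2) 2 by (auto simp: replace_disjoint)
  qed
next
  case (Or f g)
  then consider "Exists y D \<phi> \<in> subformulas f" | "Exists y D \<phi> \<in> subformulas g" by auto
  then show ?case
  proof cases
    case 1
    then have "y \<notin> V_ex g" using Or.prems Exists_subformula_disjoint(1)[OF 1] by simp
    then show ?thesis using Or.prems Or.IH(1) 1 by (auto simp: replace_disjoint)
  next
    case 2
    then have "y \<notin> V_ex f" using Or.prems Exists_subformula_disjoint(1)[OF 2] by simp
    then show ?thesis using Or.prems Or.IH(2) 2 by (auto simp: replace_disjoint)
  qed
next
  case (Exists v E f)
  show ?case
  proof (cases "Exists v E f = Exists y D \<phi>")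
    case True
    then show ?thesis using V_phi V_q by (auto simp: V_Q_def)
  next
    case False
    then have sub: "Exists y D \<phi> \<in> subformulas f" using Exists.prems by auto
    then have "v \<noteq> y"
      using Exists.prems Exists_subformula_V_ex[OF sub] by (auto simp: V_Q_def)
    then show ?thesis using False sub Exists by auto
  qed
qed auto

text \<open>
  Monotonicity of the context of the replaced subformula, for truth (\<open>b = True\<close>) and, read
  contrapositively, for falsity (\<open>b = False\<close>).
\<close>

lemma subst_funs_replace:
  assumes agree: "\<And>v. v \<noteq> y \<Longrightarrow> \<sigma> v a = \<tau> v a"
    and imp: "subst_funs \<sigma> \<phi> a = b \<Longrightarrow> subst_funs \<tau> q a = b"
  shows "well_scoped f \<Longrightarrow> Exists y D \<phi> \<in> subformulas f \<Longrightarrow> subst_funs \<sigma> f a = b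
    \<Longrightarrow> subst_funs \<tau> (replace (Exists y D \<phi>) q f) a = b"
proof -
  \<comment> \<open>The operand without the subformula keeps its shape and, as \<open>y\<close> does
    not occur in it, its value.\<close>
  have other: "replace (Exists y D \<phi>) q h = h" "subst_funs \<tau> h a = subst_funs \<sigma> h a"
    if "Exists y D \<phi> \<in> subformulas g" "compatible g h" "compatible h g" for g h
  proof -
    note y = Exists_subformula_disjoint[OF that]
    show "replace (Exists y D \<phi>) q h = h" using y(1) by (rule replace_disjoint)
    show "subst_funs \<tau> h a = subst_funs \<sigma> h a"
      using y(2) agree by (intro subst_funs_cong) metis
  qed
  show "well_scoped f \<Longrightarrow> Exists y D \<phi> \<in> subformulas f \<Longrightarrow> subst_funs \<sigma> f a = b
    \<Longrightarrow> subst_funs \<tau> (replace (Exists y D \<phi>) q f) a = b"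
  proof (induction f)
    case (And f g)
    then consider "Exists y D \<phi> \<in> subformulas f" | "Exists y D \<phi> \<in> subformulas g" by auto
    then show ?case
    proof cases
      case 1
      then show ?thesis using And.prems And.IH(1) other[OF 1, of g] by (cases b) auto
    next
      case 2
      then show ?thesis using And.prems And.IH(2) other[OF 2, of f] by (cases b) auto
    qed
  next
    case (Or f g)
    then consider "Exists y D \<phi> \<in> subformulas f" | "Exists y D \<phi> \<in> subformulas g" by auto
    then show ?case
    proof cases
      case 1
      then show ?thesis using Or.prems Or.IH(1) other[OF 1, of g] by (cases b) auto
    next
      case 2
      then show ?thesis using Or.prems Or.IH(2) other[OF 2, of f] by (cases b) auto
    qed
  next
    case (Exists v E f)
    then show ?case using imp by (cases "Exists v E f = Exists y D \<phi>") auto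
  qed auto
qed

end

section \<open>Transfer of Skolem functions between \<psi> and \<psi>'\<close>

theorem theorem7:
  fixes \<psi> \<psi>' \<phi> :: "('v::finite) dqbf" and y :: 'v and D\<^sub>y :: "'v set"
  assumes "\<psi> \<in> DQBF"
    and "Exists y D\<^sub>y \<phi> \<in> subformulas \<psi>"
    and "V_all \<phi> = {}" and "V_ex \<phi> = {}"
    and "V_of \<phi> \<subseteq> D\<^sub>y \<union> V_free \<psi> \<union> {v \<in> V_ex \<psi>. dep \<psi> v \<subseteq> D\<^sub>y}"
    and "\<psi>' = replace (Exists y D\<^sub>y \<phi>) (Or (subst_const False y \<phi>) (subst_const True y \<phi>)) \<psi>"
  shows "\<psi> \<approx> \<psi>'"
proof -
  let ?q = "Or (subst_const False y \<phi>) (subst_const True y \<phi>)"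
  have ws: "well_scoped \<psi>" using assms(1) by (rule DQBF_well_scoped)
  have QF: "V_Q \<phi> = {}" "V_Q ?q = {}" using assms(3,4) by (auto simp: V_Q_def)
  have y_ex: "y \<in> V_ex \<psi>" and D_dep: "D\<^sub>y \<subseteq> dep \<psi> y"
    using Exists_subformula_V_ex[OF assms(2)] Exists_subformula_dep[OF assms(2)] by simp_all
  have y_all: "y \<notin> V_all \<psi>" using V_ex_Int_V_all[OF ws] y_ex by auto
  have D_ex: "D\<^sub>y \<inter> V_ex \<psi> = {}" using dep_Int_V_ex[OF ws, of y] D_dep by auto
  have all': "V_all \<psi>' = V_all \<psi>" using V_all_replace[OF QF] assms(6) by simp
  have ex': "V_ex \<psi>' = V_ex \<psi> - {y}" using V_ex_replace[OF QF ws assms(2)] assms(6) by simp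
  \<comment> \<open>Having lost its quantifier, \<open>y\<close> is free in \<psi>', where
    candidates must make it constant.\<close>
  have free': "V_free \<psi>' = V_free \<psi> \<union> {y}"
    using y_all by (auto simp: V_free_def V_Q_def ex' all')
  have dom': "V_free \<psi>' \<union> V_ex \<psi>' = V_free \<psi> \<union> V_ex \<psi>" using free' ex' y_ex by auto
  have dep': "dep \<psi>' v = dep \<psi> v" if "v \<noteq> y" for v
    using dep_replace[OF QF that] assms(6) by simp
  \<comment> \<open>By \<open>dom'\<close> the same interpretation serves both formulas.\<close>
  define I where "I s = (\<lambda>v. if v \<in> V_free \<psi> \<union> V_ex \<psi> then s v else (\<lambda>a. a v))"
    for s :: "'v \<Rightarrow> 'v bool_fun"
  have app: "apply_skolem s \<psi> = subst_funs (I s) \<psi>" "apply_skolem s \<psi>' = subst_funs (I s) \<psi>'" for s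
    unfolding apply_skolem_def dom' I_def by simp_all
  have q_eq: "subst_funs \<sigma> ?q a \<longleftrightarrow>
      subst_funs (\<sigma>(y := \<lambda>a. False)) \<phi> a \<or> subst_funs (\<sigma>(y := \<lambda>a. True)) \<phi> a" for \<sigma> a
    by (simp add: subst_funs_subst_const[OF QF(1)])
  \<comment> \<open>At a fixed assignment the function for \<open>y\<close> matters only through its
    value there, which selects one disjunct of \<open>?q\<close>.\<close>
  have phi_eq: "subst_funs \<sigma> \<phi> a = subst_funs (\<tau>(y := \<lambda>_. \<sigma> y a)) \<phi> a"
    if "\<And>v. v \<noteq> y \<Longrightarrow> \<sigma> v a = \<tau> v a" for \<sigma> \<tau> :: "'v \<Rightarrow> 'v bool_fun" and a
    using that by (intro subst_funs_cong) auto
  have "sem \<psi>' \<noteq> {}" if "s \<in> sem \<psi>" for s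
  proof -
    have s: "s \<in> skolem_candidates \<psi>" and taut: "\<And>a. subst_funs (I s) \<psi> a"
      using that by (auto simp: sem_def tautology_def app)
    define s' where "s' = s(y := \<lambda>a. False)"
    have cand: "s' \<in> skolem_candidates \<psi>'"
      using s unfolding skolem_candidates_def dom' all' s'_def
      by (auto simp: free' ex' dep' bool_funs_def y_ex PiE_iff extensional_def)
    have agree: "I s v a = I s' v a" if "v \<noteq> y" for v a
      using that by (auto simp: I_def s'_def)
    have "subst_funs (I s') \<psi>' a" for a
    proof -
      have "subst_funs (I s') ?q a = True" if "subst_funs (I s) \<phi> a = True"
        using that phi_eq[of "I s" a "I s'"] agree unfolding q_eq by (cases "I s y a") auto
      from subst_funs_replace[where \<sigma> = "I s" and \<tau> = "I s'" and a = a and b = True,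
          OF QF agree this ws assms(2)]
      show ?thesis using taut assms(6) by auto
    qed
    then show ?thesis using cand by (auto simp: sem_def tautology_def app)
  qed
  moreover have "sem \<psi> \<noteq> {}" if "s' \<in> sem \<psi>'" for s'
  proof -
    have s': "s' \<in> skolem_candidates \<psi>'" and taut: "\<And>a. subst_funs (I s') \<psi>' a"
      using that by (auto simp: sem_def tautology_def app)
    define \<tau> where "\<tau> = (I s')(y := \<lambda>a. True)"
    define h where "h = subst_funs \<tau> \<phi>"
    define s where "s = s'(y := h)"
    have \<tau>: "\<tau> v \<in> bool_funs (V_all \<psi>) \<and> supp (\<tau> v) \<subseteq> D\<^sub>y \<inter> V_all \<psi>" if v: "v \<in> V_of \<phi>" for v
    proof (cases "v = y")
      case True
      then show ?thesis by (simp add: \<tau>_def bool_funs_def supp_def)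
    next
      case False
      \<comment> \<open>By \<open>D_ex\<close> a member of \<open>D\<^sub>y\<close> is free or
        universal; a universal one stands for itself and has support \<open>{v}\<close>.\<close>
      consider "v \<in> V_free \<psi>" | "v \<in> V_ex \<psi>" "dep \<psi> v \<subseteq> D\<^sub>y" | "v \<in> D\<^sub>y" "v \<in> V_all \<psi>" "v \<notin> V_ex \<psi>"
        using v assms(5) D_ex by (auto simp: V_free_def V_Q_def)
      then show ?thesis
      proof cases
        case 1
        then obtain c where "s' v = (\<lambda>a. c)"
          using s' free' by (auto simp: skolem_candidates_def)
        then show ?thesis using False 1 by (simp add: \<tau>_def I_def bool_funs_def supp_def)
      next
        case 2
        then have "s' v \<in> bool_funs (V_all \<psi>)" "supp (s' v) \<subseteq> dep \<psi> v \<inter> V_all \<psi>"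
          using s' False by (auto simp: skolem_candidates_def ex' all' dep')
        then show ?thesis using False 2 by (auto simp: \<tau>_def I_def)
      next
        case 3
        then have "\<tau> v = (\<lambda>a. a v)"
          using False by (auto simp: \<tau>_def I_def V_free_def V_Q_def)
        then show ?thesis using 3 by (auto simp: bool_funs_def supp_def split: if_splits)
      qed
    qed
    have h: "h \<in> bool_funs (V_all \<psi>)" "supp h \<subseteq> D\<^sub>y \<inter> V_all \<psi>"
      using \<tau> subst_funs_bool_funs[of \<phi> \<tau>] supp_subst_funs[of \<tau> \<phi>] unfolding h_def by blast+
    have cand: "s \<in> skolem_candidates \<psi>"
    proof -
      have "s \<in> (V_free \<psi> \<union> V_ex \<psi>) \<rightarrow>\<^sub>E bool_funs (V_all \<psi>)"
        using s' h(1) y_ex unfolding skolem_candidates_def dom' all' s_def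
        by (auto simp: PiE_iff extensional_def)
      moreover have "\<exists>c. s v = (\<lambda>a. c)" if "v \<in> V_free \<psi>" for v
      proof -
        have "v \<noteq> y" using that y_ex by (auto simp: V_free_def V_Q_def)
        then show ?thesis using that s' by (auto simp: skolem_candidates_def free' s_def)
      qed
      moreover have "supp (s v) \<subseteq> dep \<psi> v \<inter> V_all \<psi>" if "v \<in> V_ex \<psi>" for v
      proof (cases "v = y")
        case True
        then show ?thesis using h(2) D_dep by (auto simp: s_def)
      next
        case False
        then show ?thesis
          using that s' by (auto simp: skolem_candidates_def ex' all' dep' s_def)
      qed
      ultimately show ?thesis by (auto simp: skolem_candidates_def)
    qed
    have agree: "I s v a = I s' v a" if "v \<noteq> y" for v a
      using that by (auto simp: I_def s_def)
    have Iy: "I s y = h" using y_ex by (simp add: I_def s_def)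
    have "subst_funs (I s) \<psi> a" for a
    \<comment> \<open>Monotonicity leads from \<psi> to \<psi>', so here it is falsity that is
      carried over.\<close>
    proof (rule ccontr)
      assume "\<not> subst_funs (I s) \<psi> a"
      then have F: "subst_funs (I s) \<psi> a = False" by simp
      \<comment> \<open>If \<open>h a\<close> held, \<phi> would be evaluated with \<open>y\<close>
        true and have the value \<open>h a\<close>, hence be true. So \<open>h a\<close> is false,
        which refutes the second disjunct, and \<phi> is evaluated with \<open>y\<close> false,
        which refutes the first.\<close>
      have "subst_funs (I s') ?q a = False" if "subst_funs (I s) \<phi> a = False"
        using that phi_eq[of "I s" a "I s'"] agree unfolding q_eq Iy
        by (cases "h a") (auto simp: h_def \<tau>_def)
      from subst_funs_replace[where \<sigma> = "I s" and \<tau> = "I s'" and a = a and b = False,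
          OF QF agree this ws assms(2) F]
      show False using taut assms(6) by auto
    qed
    then show ?thesis using cand by (auto simp: sem_def tautology_def app)
  qed
  ultimately show ?thesis unfolding equisatisfiable_def by blast
qed

end
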